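(* (Alternation Theorem) Let $\{\psi_i\}_{i=1}^n$ be a system of real-valued continuous functions on $\Omega=[a,b]$ satisfying the Haar condition, and let $\mathbb{P}_n=\mathrm{span}(\psi_1,\dots,\psi_n)$. Let $X=\{x_1,\dots,x_m\}$ with $a\le x_1<x_2<\dots<x_m\le b$ and $m\ge n+1$, let $f$ be a real-valued function on $[a,b]$, and put $f_j=f(x_j)$. For $p\in\mathbb{P}_n$ write $\|p(x)-f\|_\infty=\max_{1\le j\le m}|p(x_j)-f_j|$. Then $p^*\in\mathbb{P}_n$ is the unique solution of $$\min_{p\in\mathbb{P}_n}\ \max_{1\le j\le m}|f_j-p(x_j)|$$ if and only if there are at least $n+1$ points $x_{\beta_1}<x_{\beta_2}<\dots<x_{\beta_{n+1}}$ in $X$ such that either $$p^*(x_{\beta_j})-f_{\beta_j}=(-1)^{j}\,\|p^*(x)-f\|_\infty\quad\text{for all }1\le j\le n+1,$$ or $$p^*(x_{\beta_j})-f_{\beta_j}=(-1)^{j+1}\,\|p^*(x)-f\|_\infty\quad\text{for all }1\le j\le n+1 .$$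
   Context: Real case: all functions are real-valued and $\mathbb{P}_n$ is the real linear span of $\psi_1,\dots,\psi_n$. The system $\{\psi_i\}_{i=1}^n$ satisfies the Haar condition on $[a,b]$ if the $n\times n$ matrix $[\psi_i(z_j)]_{i,j=1}^n$ is invertible for every choice of $n$ distinct points $z_1,\dots,z_n\in[a,b]$. Under this condition the discrete Chebyshev approximation problem on $X$ has exactly one solution (a known fact). *)

theory Defs
  imports Complex_Main "HOL-Library.FuncSet" "Jordan_Normal_Form.Matrix"
begin

(* The basis functions and the points are indexed from 1, whereas the library's matrices are
   indexed from 0; hence the shifts by Suc. *)
definition haar_condition :: "nat \<Rightarrow> (nat \<Rightarrow> real \<Rightarrow> real) \<Rightarrow> real \<Rightarrow> real \<Rightarrow> bool" where
  "haar_condition n \<psi> a b \<longleftrightarrow>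
     (\<forall>z :: nat \<Rightarrow> real. z ` {1..n} \<subseteq> {a..b} \<and> inj_on z {1..n} \<longrightarrow>
        invertible_mat (mat n n (\<lambda>(i, j). \<psi> (Suc i) (z (Suc j)))))"

(* The elements of the span are functions on [a,b]. They are represented by total functions
   that are undefined outside [a,b], so that equality in the span is equality on [a,b]. *)
definition span_on :: "nat \<Rightarrow> (nat \<Rightarrow> real \<Rightarrow> real) \<Rightarrow> real \<Rightarrow> real \<Rightarrow> (real \<Rightarrow> real) set" where
  "span_on n \<psi> a b = {p. \<exists>c :: nat \<Rightarrow> real. p = (\<lambda>t\<in>{a..b}. \<Sum>i=1..n. c i * \<psi> i t)}"

definition discrete_norm :: "nat \<Rightarrow> (nat \<Rightarrow> real) \<Rightarrow> (real \<Rightarrow> real) \<Rightarrow> real" where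
  "discrete_norm m x g = (MAX j\<in>{1..m}. \<bar>g (x j)\<bar>)"

definition minimax_solution ::
  "(real \<Rightarrow> real) set \<Rightarrow> nat \<Rightarrow> (nat \<Rightarrow> real) \<Rightarrow> (real \<Rightarrow> real) \<Rightarrow> (real \<Rightarrow> real) \<Rightarrow> bool" where
  "minimax_solution P m x f p \<longleftrightarrow>
     is_arg_min (\<lambda>q. MAX j\<in>{1..m}. \<bar>f (x j) - q (x j)\<bar>) (\<lambda>q. q \<in> P) p"

end

theory Submission
  imports Defs "HOL-Library.Infinite_Set"
begin

text \<open>
  Work with linear relations between point evaluations. On \<open>n + 1\<close> points of \<open>[a,b]\<close> the Haar
  condition leaves exactly a line of weights \<open>w\<close> with \<open>\<Sum>t\<in>A. w t * p t = 0\<close> for all \<open>p\<close> in the span;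
  those that are not all zero vanish nowhere on \<open>A\<close> (\<open>annihilator_nonzero\<close>), and the intermediate
  value theorem forces their signs to alternate from left to right (\<open>annihilator_neighbours\<close>). Hence an error that alternates
  on \<open>A\<close> with modulus \<open>h\<close> is the same thing as an error of the form \<open>sgn (w t) * h\<close>, a levelled error
  (\<open>levelled_iff_alternates\<close>), and this second form does not refer to the order of the points.

  A levelled error certifies optimality: if \<open>q\<close> has an error of modulus at most \<open>h\<close> on \<open>A\<close>, then all terms
  of \<open>\<Sum>t\<in>A. w t * (q t - p t) = 0\<close> are nonnegative, so \<open>q\<close> and \<open>p\<close> agree on \<open>n + 1\<close> points and are
  equal (\<open>levelled_rigid\<close>). This is the direction from alternation to unique optimality.

  For the converse, each of the finitely many \<open>(n + 1)\<close>-element subsets of \<open>X\<close> carries a levelled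
  error. Take a subset with the largest \<open>h\<close>. Were the error larger than \<open>h\<close> at a further point of \<open>X\<close>,
  that point could be exchanged for one of the subset in such a way that \<open>h\<close> grows (\<open>levelled_grows\<close>); this
  is the ratio test of the simplex method. So the levelled function belonging to this subset has error at
  most \<open>h\<close> on all of \<open>X\<close>. Any minimizer has error at most \<open>h\<close> as well, hence equals it by rigidity,
  and inherits its alternation.
\<close>

section \<open>Solving linear systems with an invertible matrix\<close>

lemma invertible_mat_solve:
  fixes M :: "'a :: comm_semiring_1 mat"
  assumes "invertible_mat M" and M: "M \<in> carrier_mat n n"
  shows "\<exists>v. \<forall>i<n. (\<Sum>j<n. M $$ (i, j) * v j) = r i"
    and "\<exists>v. \<forall>j<n. (\<Sum>i<n. v i * M $$ (i, j)) = r j"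
proof -
  obtain B where B: "M * B = 1\<^sub>m n" "B * M = 1\<^sub>m (dim_row B)"
    using assms unfolding invertible_mat_def inverts_mat_def by auto
  have dims: "dim_col B = n" "dim_row B = n"
    using arg_cong[OF B(1), of dim_col] arg_cong[OF B(2), of dim_col] M by auto
  then have Bc: "B \<in> carrier_mat n n" by auto
  have MB: "(\<Sum>k<n. M $$ (i, k) * B $$ (k, j)) = (if i = j then 1 else 0)" if "i < n" "j < n" for i j
    using arg_cong[OF B(1), of "\<lambda>C. C $$ (i, j)"] that M Bc
    by (simp add: scalar_prod_def atLeast0LessThan)
  have BM: "(\<Sum>k<n. B $$ (i, k) * M $$ (k, j)) = (if i = j then 1 else 0)" if "i < n" "j < n" for i j
    using arg_cong[OF B(2), of "\<lambda>C. C $$ (i, j)"] that M Bc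
    by (simp add: scalar_prod_def atLeast0LessThan)
  have "(\<Sum>j<n. M $$ (i, j) * (\<Sum>k<n. B $$ (j, k) * r k)) = r i" if "i < n" for i
  proof -
    have "(\<Sum>j<n. M $$ (i, j) * (\<Sum>k<n. B $$ (j, k) * r k))
        = (\<Sum>k<n. (\<Sum>j<n. M $$ (i, j) * B $$ (j, k)) * r k)"
      by (simp add: sum_distrib_left sum_distrib_right mult.assoc) (rule sum.swap)
    also have "\<dots> = (\<Sum>k<n. if i = k then r k else 0)"
      using that by (intro sum.cong) (auto simp: MB)
    also have "\<dots> = r i" using that by simp
    finally show ?thesis .
  qed
  then show "\<exists>v. \<forall>i<n. (\<Sum>j<n. M $$ (i, j) * v j) = r i"
    by (intro exI[of _ "\<lambda>j. \<Sum>k<n. B $$ (j, k) * r k"]) simp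
  have "(\<Sum>i<n. (\<Sum>k<n. r k * B $$ (k, i)) * M $$ (i, j)) = r j" if "j < n" for j
  proof -
    have "(\<Sum>i<n. (\<Sum>k<n. r k * B $$ (k, i)) * M $$ (i, j))
        = (\<Sum>k<n. r k * (\<Sum>i<n. B $$ (k, i) * M $$ (i, j)))"
      by (simp add: sum_distrib_left sum_distrib_right mult.assoc) (rule sum.swap)
    also have "\<dots> = (\<Sum>k<n. if k = j then r k else 0)"
      using that by (intro sum.cong) (auto simp: BM)
    also have "\<dots> = r j" using that by simp
    finally show ?thesis .
  qed
  then show "\<exists>v. \<forall>j<n. (\<Sum>i<n. v i * M $$ (i, j)) = r j"
    by (intro exI[of _ "\<lambda>i. \<Sum>k<n. r k * B $$ (k, i)"]) simp
qed

section \<open>Interpolation in a Haar system\<close>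

locale haar_system =
  fixes n :: nat and \<psi> :: "nat \<Rightarrow> real \<Rightarrow> real" and a b :: real
  assumes haar: "haar_condition n \<psi> a b"
    and continuous: "\<And>i. i \<in> {1..n} \<Longrightarrow> continuous_on {a..b} (\<psi> i)"
begin

definition lincomb :: "(nat \<Rightarrow> real) \<Rightarrow> real \<Rightarrow> real" where
  "lincomb c t = (\<Sum>i=1..n. c i * \<psi> i t)"

lemma continuous_on_lincomb: "continuous_on {a..b} (lincomb c)"
  unfolding lincomb_def [abs_def]
  by (intro continuous_on_sum continuous_on_mult continuous_on_const continuous)

lemma haar_solve:
  assumes z: "z ` {1..n} \<subseteq> {a..b}" "inj_on z {1..n}"
  shows "\<exists>u. \<forall>i\<in>{1..n}. (\<Sum>j=1..n. \<psi> i (z j) * u j) = r i"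
    and "\<exists>c. \<forall>j\<in>{1..n}. lincomb c (z j) = r j"
proof -
  let ?M = "mat n n (\<lambda>(i, j). \<psi> (Suc i) (z (Suc j)))"
  have inv: "invertible_mat ?M" "?M \<in> carrier_mat n n"
    using haar z unfolding haar_condition_def by auto
  have range: "i - 1 < n" "Suc (i - 1) = i" if "i \<in> {1..n}" for i
    using that by auto
  have shift: "(\<Sum>j=1..n. g j) = (\<Sum>j<n. g (Suc j))" for g :: "nat \<Rightarrow> real"
    by (simp add: sum.atLeast1_atMost_eq)
  obtain u where u: "\<And>i. i < n \<Longrightarrow> (\<Sum>j<n. ?M $$ (i, j) * u j) = r (Suc i)"
    using invertible_mat_solve(1)[OF inv, of "\<lambda>i. r (Suc i)"] by blast
  have "(\<Sum>j=1..n. \<psi> i (z j) * u (j - 1)) = r i" if "i \<in> {1..n}" for i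
    using u[OF range(1)[OF that]] range[OF that] unfolding shift by simp
  then show "\<exists>u. \<forall>i\<in>{1..n}. (\<Sum>j=1..n. \<psi> i (z j) * u j) = r i"
    by (intro exI[of _ "\<lambda>j. u (j - 1)"]) simp
  obtain c where c: "\<And>j. j < n \<Longrightarrow> (\<Sum>i<n. c i * ?M $$ (i, j)) = r (Suc j)"
    using invertible_mat_solve(2)[OF inv, of "\<lambda>i. r (Suc i)"] by blast
  have "lincomb (\<lambda>i. c (i - 1)) (z j) = r j" if "j \<in> {1..n}" for j
    using c[OF range(1)[OF that]] range[OF that] unfolding lincomb_def shift by simp
  then show "\<exists>c. \<forall>j\<in>{1..n}. lincomb c (z j) = r j"
    by (intro exI[of _ "\<lambda>i. c (i - 1)"]) simp
qed

lemma interpolation: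
  assumes A: "finite A" "A \<subseteq> {a..b}" "card A = n"
  shows "\<exists>c. \<forall>t\<in>A. lincomb c t = v t"
proof -
  obtain z where z: "bij_betw z {1..n} A"
    using ex_bij_betw_nat_finite_1[OF A(1)] A(3) by auto
  have zA: "z ` {1..n} = A" "inj_on z {1..n}"
    using z by (auto simp: bij_betw_def)
  obtain c where "\<forall>j\<in>{1..n}. lincomb c (z j) = v (z j)"
    using haar_solve(2)[of z "\<lambda>j. v (z j)", unfolded zA(1), OF A(2) zA(2)] by blast
  then show ?thesis using zA(1) by blast
qed

text \<open>Dually to interpolation, \<open>n\<close> evaluations span the dual space, because the transposed matrix
  is invertible too.\<close>

lemma evaluation_spanned:
  assumes A: "finite A" "A \<subseteq> {a..b}" "card A = n"
  shows "\<exists>u. \<forall>c. lincomb c t = (\<Sum>s\<in>A. u s * lincomb c s)"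
proof -
  obtain z where z: "bij_betw z {1..n} A"
    using ex_bij_betw_nat_finite_1[OF A(1)] A(3) by auto
  have zA: "z ` {1..n} = A" "inj_on z {1..n}"
    using z by (auto simp: bij_betw_def)
  obtain u where u: "\<And>i. i \<in> {1..n} \<Longrightarrow> (\<Sum>j=1..n. \<psi> i (z j) * u j) = \<psi> i t"
    using haar_solve(1)[of z "\<lambda>i. \<psi> i t", unfolded zA(1), OF A(2) zA(2)] by blast
  have "lincomb c t = (\<Sum>s\<in>A. u (inv_into {1..n} z s) * lincomb c s)" for c
  proof -
    have "(\<Sum>s\<in>A. u (inv_into {1..n} z s) * lincomb c s) = (\<Sum>j=1..n. u j * lincomb c (z j))"
      unfolding zA(1)[symmetric] sum.reindex[OF zA(2)] o_def using inv_into_f_f[OF zA(2)] by simp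
    also have "\<dots> = (\<Sum>j=1..n. \<Sum>i=1..n. c i * (\<psi> i (z j) * u j))"
      by (simp add: lincomb_def sum_distrib_left mult_ac)
    also have "\<dots> = (\<Sum>i=1..n. c i * (\<Sum>j=1..n. \<psi> i (z j) * u j))"
      by (subst sum.swap) (simp add: sum_distrib_left)
    also have "\<dots> = lincomb c t"
      unfolding lincomb_def by (intro sum.cong refl) (simp only: u)
    finally show ?thesis by simp
  qed
  then show ?thesis
    by (intro exI[of _ "\<lambda>s. u (inv_into {1..n} z s)"]) simp
qed

lemma lincomb_eqI:
  assumes "finite A" "A \<subseteq> {a..b}" "card A = n" "\<And>s. s \<in> A \<Longrightarrow> lincomb c s = lincomb c' s"
  shows "lincomb c t = lincomb c' t"
proof -
  obtain u where "\<And>c. lincomb c t = (\<Sum>s\<in>A. u s * lincomb c s)"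
    using evaluation_spanned[OF assms(1-3), of t] by blast
  then show ?thesis using assms(4) by simp
qed

lemma lincomb_zero: "lincomb (\<lambda>_. 0) t = 0"
  by (simp add: lincomb_def)

section \<open>Annihilating weights\<close>

definition annihilates :: "real set \<Rightarrow> (real \<Rightarrow> real) \<Rightarrow> bool" where
  "annihilates A w \<longleftrightarrow> (\<forall>c. (\<Sum>t\<in>A. w t * lincomb c t) = 0)"

text \<open>\<open>n + 1\<close> points on which a levelled error can live.\<close>

definition reference :: "real set \<Rightarrow> bool" where
  "reference A \<longleftrightarrow> A \<subseteq> {a..b} \<and> card A = Suc n"

lemma referenceD:
  assumes "reference A"
  shows "finite A" "A \<subseteq> {a..b}" "card A = Suc n" "A \<noteq> {}"
  using assms card.infinite[of A] by (auto simp: reference_def)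

lemma reference_Diff:
  assumes "reference A" "s \<in> A"
  shows "finite (A - {s})" "A - {s} \<subseteq> {a..b}" "card (A - {s}) = n"
  using referenceD[OF assms(1)] assms(2) by auto

text \<open>If one weight were zero, the others would annihilate the span on \<open>n\<close> points, where
  interpolating an indicator function shows that they are all zero.\<close>

lemma annihilator_nonzero:
  assumes A: "reference A" and w: "annihilates A w" and t: "t \<in> A" "w t \<noteq> 0" and s: "s \<in> A"
  shows "w s \<noteq> 0"
proof
  assume ws: "w s = 0"
  note As = reference_Diff[OF A s]
  obtain c where c: "\<forall>r\<in>A - {s}. lincomb c r = (if r = t then 1 else 0)"
    using interpolation[OF As, of "\<lambda>r. if r = t then 1 else 0"] by blast
  have "w r * lincomb c r = (if r = t then w t else 0)" if "r \<in> A" for r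
    using c ws t that by (cases "r = s") auto
  then have "(\<Sum>r\<in>A. w r * lincomb c r) = (\<Sum>r\<in>A. if r = t then w t else 0)"
    by simp
  also have "\<dots> = w t"
    using t(1) referenceD(1)[OF A] by simp
  finally show False using t(2) w by (simp add: annihilates_def)
qed

lemma annihilator_exists:
  assumes A: "reference A"
  shows "\<exists>w. annihilates A w \<and> (\<forall>t\<in>A. w t \<noteq> 0)"
proof -
  obtain t where t: "t \<in> A" using referenceD(4)[OF A] by blast
  obtain u where u: "\<And>c. lincomb c t = (\<Sum>s\<in>A - {t}. u s * lincomb c s)"
    using evaluation_spanned[OF reference_Diff[OF A t], of t] by blast
  define w where "w = u(t := - 1)"
  have "(\<Sum>s\<in>A. w s * lincomb c s) = 0" for c
  proof -
    have "(\<Sum>s\<in>A. w s * lincomb c s) = w t * lincomb c t + (\<Sum>s\<in>A - {t}. w s * lincomb c s)"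
      using referenceD(1)[OF A] t by (rule sum.remove)
    also have "(\<Sum>s\<in>A - {t}. w s * lincomb c s) = lincomb c t"
      unfolding u by (intro sum.cong) (auto simp: w_def)
    finally show ?thesis by (simp add: w_def)
  qed
  then have "annihilates A w" by (simp add: annihilates_def)
  moreover have "w t \<noteq> 0" by (simp add: w_def)
  ultimately show ?thesis using annihilator_nonzero[OF A _ t] by blast
qed

lemma annihilates_scale: "annihilates A w \<Longrightarrow> annihilates A (\<lambda>t. \<mu> * w t)"
  by (simp add: annihilates_def mult.assoc flip: sum_distrib_left)

text \<open>For the function \<open>p\<close> with \<open>p s = 1\<close> that vanishes on \<open>A - {s, t}\<close>, annihilation reads
  \<open>w s + w t * p t = 0\<close>. If \<open>p t\<close> were not positive, \<open>p\<close> would have an \<open>n\<close>-th zero between \<open>s\<close>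
  and \<open>t\<close> or at \<open>t\<close>.\<close>

lemma annihilator_neighbours:
  assumes A: "reference A" and w: "annihilates A w" "\<And>r. r \<in> A \<Longrightarrow> w r \<noteq> 0"
    and st: "s \<in> A" "t \<in> A" "s < t" and gap: "A \<inter> {s<..<t} = {}"
  shows "w s * w t < 0"
proof -
  note At = reference_Diff[OF A st(2)]
  obtain c where "\<forall>r\<in>A - {t}. lincomb c r = (if r = s then 1 else 0)"
    using interpolation[OF At, of "\<lambda>r. if r = s then 1 else 0"] by blast
  then have c: "lincomb c s = 1" "\<And>r. r \<in> A - {s, t} \<Longrightarrow> lincomb c r = 0"
    using st by auto
  have pos: "lincomb c t > 0"
  proof (rule ccontr)
    assume "\<not> lincomb c t > 0"
    moreover have sub: "{s..t} \<subseteq> {a..b}" using referenceD(2)[OF A] st by auto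
    ultimately obtain z where z: "s \<le> z" "z \<le> t" "lincomb c z = 0"
      using IVT2'[of "lincomb c" t 0 s] c(1) st(3) continuous_on_subset[OF continuous_on_lincomb]
      by auto
    have zA: "z \<notin> A - {s, t}" "z \<noteq> s" using gap z c(1) st by auto
    let ?Z = "insert z (A - {s, t})"
    have "card (A - {s, t}) = n - 1" "n > 0"
      using card_Diff_subset[of "{s, t}" A] card_mono[of A "{s, t}"] referenceD[OF A] st by auto
    then have Z: "card ?Z = n" using zA referenceD(1)[OF A] by simp
    have Z': "finite ?Z" "?Z \<subseteq> {a..b}" using referenceD[OF A] z sub by auto
    have "lincomb c r = lincomb (\<lambda>_. 0) r" if "r \<in> ?Z" for r
      using that c(2) z(3) by (auto simp: lincomb_zero)
    then have "lincomb c s = lincomb (\<lambda>_. 0) s" by (rule lincomb_eqI[OF Z' Z])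
    then show False using c(1) by (simp add: lincomb_zero)
  qed
  have "0 = (\<Sum>r\<in>A. w r * lincomb c r)" using w(1) by (simp add: annihilates_def)
  also have "\<dots> = (\<Sum>r\<in>{s, t}. w r * lincomb c r)"
    using referenceD(1)[OF A] st c(2) by (intro sum.mono_neutral_right) auto
  also have "\<dots> = w s + w t * lincomb c t" using st(3) c(1) by simp
  finally have "w s = - (w t * lincomb c t)" by simp
  then have "w s * w t = - ((w t)\<^sup>2 * lincomb c t)" by (simp add: power2_eq_square)
  moreover have "(w t)\<^sup>2 * lincomb c t > 0" using w(2)[OF st(2)] pos by simp
  ultimately show ?thesis by simp
qed

lemma annihilator_alternates:
  assumes y: "strict_mono_on {1..Suc n} y" "y ` {1..Suc n} \<subseteq> {a..b}"
    and w: "annihilates (y ` {1..Suc n}) w" "\<And>r. r \<in> y ` {1..Suc n} \<Longrightarrow> w r \<noteq> 0"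
  shows "\<exists>\<sigma>\<in>{1, -1}. \<forall>j\<in>{1..Suc n}. sgn (w (y j)) = \<sigma> * (-1) ^ j"
proof -
  have inj: "inj_on y {1..Suc n}" using y(1) by (rule strict_mono_on_imp_inj_on)
  have A: "reference (y ` {1..Suc n})"
    using y(2) card_image[OF inj] by (simp add: reference_def)
  have sgn_next: "sgn (w (y (Suc j))) = - sgn (w (y j))" if j: "j \<in> {1..n}" for j
  proof -
    have "y j < y (Suc j)" using j y(1) by (auto simp: strict_mono_on_def)
    moreover have "y i \<le> y j \<or> y (Suc j) \<le> y i" if i: "i \<in> {1..Suc n}" for i
      using strict_mono_on_leD[OF y(1), of i j] strict_mono_on_leD[OF y(1), of "Suc j" i] i j
      by (cases "i \<le> j") auto
    then have "y ` {1..Suc n} \<inter> {y j<..<y (Suc j)} = {}" by force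
    ultimately have "w (y j) * w (y (Suc j)) < 0"
      using j by (intro annihilator_neighbours[OF A w]) auto
    then show ?thesis by (auto simp: mult_less_0_iff)
  qed
  have "sgn (w (y j)) = - sgn (w (y 1)) * (-1) ^ j" if "j \<in> {1..Suc n}" for j
  proof -
    from that have "1 \<le> j" "j \<le> Suc n" by auto
    then show ?thesis
    proof (induction j rule: dec_induct)
      case (step k)
      then show ?case using sgn_next[of k] by simp
    qed simp
  qed
  moreover have "- sgn (w (y 1)) \<in> {1, -1}" using w(2)[of "y 1"] by (auto simp: sgn_if)
  ultimately show ?thesis by blast
qed

section \<open>Levelled errors\<close>

text \<open>The signs of annihilating weights replace alternating signs, so that points can be exchanged
  without keeping track of their order.\<close>

definition levelled :: "(real \<Rightarrow> real) \<Rightarrow> real set \<Rightarrow> real \<Rightarrow> (nat \<Rightarrow> real) \<Rightarrow> bool" where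
  "levelled f A h c \<longleftrightarrow> 0 \<le> h \<and>
     (\<exists>w. annihilates A w \<and> (\<forall>t\<in>A. w t \<noteq> 0 \<and> f t - lincomb c t = sgn (w t) * h))"

lemma levelled_abs:
  assumes "levelled f A h c" "t \<in> A"
  shows "\<bar>f t - lincomb c t\<bar> = h"
  using assms by (auto simp: levelled_def abs_mult)

text \<open>Interpolating \<open>f t - sgn (w t) * h\<close> on \<open>n\<close> of the points is possible for any \<open>h\<close>; the remaining
  equation is the pairing with \<open>w\<close> and determines \<open>h\<close>.\<close>

lemma levelled_exists:
  assumes A: "reference A"
  shows "\<exists>h c. levelled f A h c"
proof -
  obtain w where w: "annihilates A w" "\<And>t. t \<in> A \<Longrightarrow> w t \<noteq> 0"
    using annihilator_exists[OF A] by blast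
  define h where "h = (\<Sum>t\<in>A. w t * f t) / (\<Sum>t\<in>A. \<bar>w t\<bar>)"
  have W: "(\<Sum>t\<in>A. \<bar>w t\<bar>) > 0"
    using referenceD[OF A] w(2) by (intro sum_pos) auto
  obtain t0 where t0: "t0 \<in> A" using referenceD(4)[OF A] by blast
  obtain c where c: "\<And>t. t \<in> A - {t0} \<Longrightarrow> lincomb c t = f t - sgn (w t) * h"
    using interpolation[OF reference_Diff[OF A t0], of "\<lambda>t. f t - sgn (w t) * h"] by blast
  have "(\<Sum>t\<in>A. w t * (f t - lincomb c t - sgn (w t) * h))
      = (\<Sum>t\<in>A. w t * f t - w t * lincomb c t - \<bar>w t\<bar> * h)"
    by (intro sum.cong) (auto simp: algebra_simps abs_sgn)
  also have "\<dots> = (\<Sum>t\<in>A. w t * f t) - (\<Sum>t\<in>A. \<bar>w t\<bar>) * h"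
    using w(1) by (simp add: sum_subtractf annihilates_def sum_distrib_right)
  also have "\<dots> = 0" using W by (simp add: h_def)
  finally have "w t0 * (f t0 - lincomb c t0 - sgn (w t0) * h)
      + (\<Sum>t\<in>A - {t0}. w t * (f t - lincomb c t - sgn (w t) * h)) = 0"
    using sum.remove[OF referenceD(1)[OF A] t0] by metis
  then have "f t0 - lincomb c t0 = sgn (w t0) * h"
    using c w(2)[OF t0] by simp
  then have err: "f t - lincomb c t = sgn (w t) * h" if "t \<in> A" for t
    using c that by (cases "t = t0") auto
  \<comment> \<open>The weights are determined only up to sign, so a negative \<open>h\<close> is absorbed by negating them.\<close>
  show ?thesis
  proof (cases "h \<ge> 0")
    case True
    then have "levelled f A h c" using w err by (auto simp: levelled_def)
    then show ?thesis by blast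
  next
    case False
    have "annihilates A (\<lambda>t. - w t)" using annihilates_scale[OF w(1), of "- 1"] by simp
    then have "levelled f A (- h) c" using False w(2) err
      by (auto simp: levelled_def sgn_minus intro!: exI[of _ "\<lambda>t. - w t"])
    then show ?thesis by blast
  qed
qed

lemma levelled_rigid:
  assumes A: "reference A" and lev: "levelled f A h c"
    and le: "\<And>t. t \<in> A \<Longrightarrow> \<bar>f t - lincomb c' t\<bar> \<le> h"
  shows "lincomb c' t = lincomb c t"
proof -
  obtain w where w: "annihilates A w" "\<And>t. t \<in> A \<Longrightarrow> w t \<noteq> 0"
      "\<And>t. t \<in> A \<Longrightarrow> f t - lincomb c t = sgn (w t) * h"
    using lev unfolding levelled_def by blast
  have nonneg: "w t * (lincomb c' t - lincomb c t) \<ge> 0" if t: "t \<in> A" for t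
  proof -
    have "w t * (f t - lincomb c' t) \<le> \<bar>w t\<bar> * h"
      using mult_left_mono[OF le[OF t], of "\<bar>w t\<bar>"] abs_ge_self[of "w t * (f t - lincomb c' t)"]
      by (simp add: abs_mult)
    moreover have "w t * (f t - lincomb c t) = \<bar>w t\<bar> * h"
      by (simp add: w(3)[OF t] abs_sgn)
    ultimately show ?thesis by (simp add: algebra_simps)
  qed
  have "(\<Sum>t\<in>A. w t * (lincomb c' t - lincomb c t)) = 0"
    using w(1) by (simp add: right_diff_distrib sum_subtractf annihilates_def)
  then have "\<forall>t\<in>A. w t * (lincomb c' t - lincomb c t) = 0"
    using sum_nonneg_eq_0_iff[OF referenceD(1)[OF A], of "\<lambda>t. w t * (lincomb c' t - lincomb c t)"]
      nonneg by simp
  then have eq: "lincomb c' s = lincomb c s" if "s \<in> A" for s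
    using that w(2) by auto
  obtain t0 where "t0 \<in> A" using referenceD(4)[OF A] by blast
  from lincomb_eqI[OF reference_Diff[OF A this]] eq show ?thesis by blast
qed

text \<open>The ratio test: the evaluation at \<open>x\<close> is a combination of evaluations on \<open>A\<close>, unique up to
  multiples of \<open>w\<close>. Adding the smallest multiple of \<open>w\<close> that gives all weights on \<open>A\<close> the sign of
  \<open>w\<close> makes at least one of them vanish, namely at the point \<open>y\<close> that leaves.\<close>

lemma annihilator_exchange:
  assumes A: "reference A" and w: "annihilates A w" "\<And>t. t \<in> A \<Longrightarrow> w t \<noteq> 0" and x: "x \<notin> A"
  shows "\<exists>y\<in>A. \<exists>w'. annihilates (insert x (A - {y})) w' \<and> w' x = \<tau> \<and> (\<forall>t\<in>A. w t * w' t \<ge> 0)"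
proof -
  note fin = referenceD(1)[OF A]
  obtain t0 where t0: "t0 \<in> A" using referenceD(4)[OF A] by blast
  obtain u0 where u0: "\<And>c. lincomb c x = (\<Sum>s\<in>A - {t0}. u0 s * lincomb c s)"
    using evaluation_spanned[OF reference_Diff[OF A t0], of x] by blast
  define u where "u = u0(t0 := 0)"
  have u: "lincomb c x = (\<Sum>s\<in>A. u s * lincomb c s)" for c
    unfolding u0 using fin by (intro sum.mono_neutral_cong_left) (auto simp: u_def)
  define \<theta> where "\<theta> = Max ((\<lambda>t. \<tau> * u t / w t) ` A)"
  have "\<theta> \<in> (\<lambda>t. \<tau> * u t / w t) ` A"
    unfolding \<theta>_def using fin referenceD(4)[OF A] by (intro Max_in) auto
  then obtain y where y: "y \<in> A" "\<theta> * w y - \<tau> * u y = 0"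
    using w(2) by auto
  have sign: "w t * (\<theta> * w t - \<tau> * u t) \<ge> 0" if t: "t \<in> A" for t
  proof -
    have "\<theta> \<ge> \<tau> * u t / w t" unfolding \<theta>_def using fin t by (intro Max_ge) auto
    then have "0 \<le> (w t)\<^sup>2 * (\<theta> - \<tau> * u t / w t)" by simp
    also have "\<dots> = w t * (\<theta> * w t - \<tau> * u t)"
      using w(2)[OF t] by (simp add: field_simps power2_eq_square)
    finally show ?thesis .
  qed
  define w' where "w' = (\<lambda>t. if t = x then \<tau> else \<theta> * w t - \<tau> * u t)"
  have "(\<Sum>t\<in>insert x (A - {y}). w' t * lincomb c t) = 0" for c
  proof -
    have "(\<Sum>t\<in>insert x (A - {y}). w' t * lincomb c t)
        = \<tau> * lincomb c x + (\<Sum>t\<in>A - {y}. w' t * lincomb c t)"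
      using fin x by (simp add: w'_def)
    also have "(\<Sum>t\<in>A - {y}. w' t * lincomb c t) = (\<Sum>t\<in>A. (\<theta> * w t - \<tau> * u t) * lincomb c t)"
      using fin x y by (intro sum.mono_neutral_cong_left) (auto simp: w'_def)
    also have "\<dots> = \<theta> * (\<Sum>t\<in>A. w t * lincomb c t) - \<tau> * (\<Sum>t\<in>A. u t * lincomb c t)"
      by (simp add: left_diff_distrib sum_subtractf sum_distrib_left mult.assoc)
    also have "\<dots> = - (\<tau> * lincomb c x)"
      using w(1) by (simp add: annihilates_def flip: u)
    finally show ?thesis by simp
  qed
  then have "annihilates (insert x (A - {y})) w'" by (simp add: annihilates_def)
  moreover have "\<forall>t\<in>A. w t * w' t \<ge> 0" using sign x by (auto simp: w'_def)
  ultimately show ?thesis using y(1) by (intro bexI[of _ y] exI[of _ w']) (auto simp: w'_def)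
qed

text \<open>On the new reference the error of \<open>c\<close> has the signs of the new weights and modulus at least \<open>h\<close>,
  strictly more at \<open>x\<close>. A levelled error of modulus at most \<open>h\<close> would therefore make the pairing of the
  new weights with the difference of the two functions positive, although it is zero.\<close>

lemma levelled_grows:
  assumes A: "reference A" and lev: "levelled f A h c"
    and x: "x \<notin> A" "\<bar>f x - lincomb c x\<bar> > h"
  shows "\<exists>y\<in>A. \<forall>h' c'. levelled f (insert x (A - {y})) h' c' \<longrightarrow> h < h'"
proof -
  obtain w where w: "annihilates A w" "\<And>t. t \<in> A \<Longrightarrow> w t \<noteq> 0"
      "\<And>t. t \<in> A \<Longrightarrow> f t - lincomb c t = sgn (w t) * h" and h: "h \<ge> 0"
    using lev unfolding levelled_def by blast
  define \<tau> where "\<tau> = sgn (f x - lincomb c x)"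
  obtain y w' where y: "y \<in> A" and w': "annihilates (insert x (A - {y})) w'" "w' x = \<tau>"
      "\<And>t. t \<in> A \<Longrightarrow> w t * w' t \<ge> 0"
    using annihilator_exchange[OF A w(1,2) x(1), of \<tau>] by blast
  have "h < h'" if lev': "levelled f (insert x (A - {y})) h' c'" for h' c'
  proof (rule ccontr)
    assume "\<not> h < h'"
    then have h': "h' \<le> h" by simp
    have upper: "w' t * (f t - lincomb c' t) \<le> \<bar>w' t\<bar> * h" if "t \<in> insert x (A - {y})" for t
    proof -
      have "w' t * (f t - lincomb c' t) \<le> \<bar>w' t\<bar> * \<bar>f t - lincomb c' t\<bar>"
        using abs_ge_self[of "w' t * (f t - lincomb c' t)"] by (simp add: abs_mult)
      also have "\<dots> \<le> \<bar>w' t\<bar> * h"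
        using levelled_abs[OF lev' that] h' by (intro mult_left_mono) auto
      finally show ?thesis .
    qed
    have old: "w' t * (f t - lincomb c t) = \<bar>w' t\<bar> * h" if t: "t \<in> A" for t
    proof -
      have "w' t * sgn (w t) = \<bar>w' t\<bar>"
        using w'(3)[OF t] w(2)[OF t] by (auto simp: sgn_if zero_le_mult_iff abs_if)
      then show ?thesis by (simp add: w(3)[OF t] flip: mult.assoc)
    qed
    have new: "w' x * (f x - lincomb c x) > \<bar>w' x\<bar> * h"
      using x(2) h by (auto simp: w'(2) \<tau>_def sgn_if abs_if split: if_splits)
    let ?d = "\<lambda>t. w' t * (lincomb c' t - lincomb c t)"
    have d: "?d t = w' t * (f t - lincomb c t) - w' t * (f t - lincomb c' t)" for t
      by (simp add: algebra_simps)
    have "?d t \<ge> 0" if "t \<in> insert x (A - {y})" for t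
      using upper[OF that] old[of t] new that unfolding d by (cases "t = x") auto
    moreover have "?d x > 0" using upper[of x] new unfolding d by auto
    ultimately have "0 < (\<Sum>t\<in>insert x (A - {y}). ?d t)"
      using referenceD(1)[OF A] by (intro sum_pos2[of _ x]) auto
    also have "\<dots> = 0"
      using w'(1) by (simp only: right_diff_distrib sum_subtractf annihilates_def)
    finally show False by simp
  qed
  then show ?thesis using y by blast
qed

lemma levelled_best_exists:
  assumes X: "finite X" "X \<subseteq> {a..b}" "Suc n \<le> card X"
  shows "\<exists>A h c. A \<subseteq> X \<and> reference A \<and> levelled f A h c \<and> (\<forall>t\<in>X. \<bar>f t - lincomb c t\<bar> \<le> h)"
proof -
  define R where "R = {A. A \<subseteq> X \<and> reference A}"
  have "finite R" using X(1) by (auto simp: R_def)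
  obtain A0 where "A0 \<subseteq> X" "card A0 = Suc n"
    using obtain_subset_with_card_n[OF X(3)] by blast
  then have "R \<noteq> {}" using X(2) by (auto simp: R_def reference_def)
  have "\<forall>A\<in>R. \<exists>h c. levelled f A h c" using levelled_exists by (auto simp: R_def)
  from bchoice[OF this] obtain h where h: "\<And>A. A \<in> R \<Longrightarrow> \<exists>c. levelled f A (h A) c" by blast
  have "Max (h ` R) \<in> h ` R" using \<open>finite R\<close> \<open>R \<noteq> {}\<close> by simp
  then obtain A where A: "A \<in> R" "h A = Max (h ` R)" by auto
  then have ref: "A \<subseteq> X" "reference A" by (auto simp: R_def)
  obtain c where lev: "levelled f A (h A) c" using h[OF A(1)] by blast
  have max: "h B \<le> h A" if "B \<in> R" for B
    using that \<open>finite R\<close> A(2) by simp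
  have "\<bar>f t - lincomb c t\<bar> \<le> h A" if t: "t \<in> X" for t
  proof (rule ccontr)
    assume big: "\<not> \<bar>f t - lincomb c t\<bar> \<le> h A"
    then have tA: "t \<notin> A" using levelled_abs[OF lev] by fastforce
    with big obtain y where y: "y \<in> A"
        "\<forall>h' c'. levelled f (insert t (A - {y})) h' c' \<longrightarrow> h A < h'"
      using levelled_grows[OF ref(2) lev, of t] by force
    have "insert t (A - {y}) \<in> R"
      using reference_Diff[OF ref(2) y(1)] tA t ref X(2) by (auto simp: R_def reference_def)
    then show False using y(2) h max by fastforce
  qed
  then show ?thesis using ref lev by blast
qed

lemma levelled_iff_alternates:
  assumes y: "strict_mono_on {1..Suc n} y" "y ` {1..Suc n} \<subseteq> {a..b}" and h: "h \<ge> 0"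
  shows "levelled f (y ` {1..Suc n}) h c \<longleftrightarrow>
    (\<exists>\<sigma>\<in>{1, -1}. \<forall>j\<in>{1..Suc n}. lincomb c (y j) - f (y j) = \<sigma> * (-1) ^ j * h)"
proof
  assume "levelled f (y ` {1..Suc n}) h c"
  then obtain w where w: "annihilates (y ` {1..Suc n}) w" "\<And>t. t \<in> y ` {1..Suc n} \<Longrightarrow> w t \<noteq> 0"
      "\<And>t. t \<in> y ` {1..Suc n} \<Longrightarrow> f t - lincomb c t = sgn (w t) * h"
    unfolding levelled_def by blast
  obtain \<sigma> :: real where \<sigma>: "\<sigma> \<in> {1, -1}" "\<And>j. j \<in> {1..Suc n} \<Longrightarrow> sgn (w (y j)) = \<sigma> * (-1) ^ j"
    using annihilator_alternates[OF y w(1,2)] by blast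
  have "lincomb c (y j) - f (y j) = (- \<sigma>) * (-1) ^ j * h" if "j \<in> {1..Suc n}" for j
    using w(3)[OF imageI[OF that]] \<sigma>(2)[OF that] by simp
  moreover have "- \<sigma> \<in> {1, -1}" using \<sigma>(1) by auto
  ultimately show "\<exists>\<sigma>\<in>{1, -1}. \<forall>j\<in>{1..Suc n}. lincomb c (y j) - f (y j) = \<sigma> * (-1) ^ j * h"
    by blast
next
  assume "\<exists>\<sigma>\<in>{1, -1}. \<forall>j\<in>{1..Suc n}. lincomb c (y j) - f (y j) = \<sigma> * (-1) ^ j * h"
  then obtain \<sigma> :: real where \<sigma>: "\<sigma> \<in> {1, -1}"
      "\<And>j. j \<in> {1..Suc n} \<Longrightarrow> lincomb c (y j) - f (y j) = \<sigma> * (-1) ^ j * h"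
    by blast
  have A: "reference (y ` {1..Suc n})"
    using y(2) card_image[OF strict_mono_on_imp_inj_on[OF y(1)]] by (simp add: reference_def)
  obtain w where w: "annihilates (y ` {1..Suc n}) w" "\<And>t. t \<in> y ` {1..Suc n} \<Longrightarrow> w t \<noteq> 0"
    using annihilator_exists[OF A] by blast
  obtain \<rho> :: real where \<rho>: "\<rho> \<in> {1, -1}" "\<And>j. j \<in> {1..Suc n} \<Longrightarrow> sgn (w (y j)) = \<rho> * (-1) ^ j"
    using annihilator_alternates[OF y w] by blast
  \<comment> \<open>This factor turns the sign pattern of \<open>w\<close> into that of the error \<open>f - lincomb c\<close>.\<close>
  define \<mu> where "\<mu> = - \<sigma> * \<rho>"
  have err: "f (y j) - lincomb c (y j) = sgn (\<mu> * w (y j)) * h" if "j \<in> {1..Suc n}" for j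
    using \<sigma>(1) \<rho>(1) \<sigma>(2)[OF that] \<rho>(2)[OF that] by (auto simp: \<mu>_def sgn_mult)
  have "\<mu> \<noteq> 0" using \<sigma>(1) \<rho>(1) by (auto simp: \<mu>_def)
  then have "\<forall>t\<in>y ` {1..Suc n}. \<mu> * w t \<noteq> 0 \<and> f t - lincomb c t = sgn (\<mu> * w t) * h"
    using w(2) err by (intro ballI) (erule imageE, simp)
  then show "levelled f (y ` {1..Suc n}) h c"
    unfolding levelled_def
    by (intro conjI h exI[of _ "\<lambda>t. \<mu> * w t"] annihilates_scale w(1))
qed

end

section \<open>The alternation theorem\<close>

theorem theorem3p1:
  fixes n m :: nat
    and a b :: real
    and \<psi> :: "nat \<Rightarrow> real \<Rightarrow> real"
    and x :: "nat \<Rightarrow> real"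
    and f pstar :: "real \<Rightarrow> real"
  assumes "n \<ge> 1"
    and "\<And>i. i \<in> {1..n} \<Longrightarrow> continuous_on {a..b} (\<psi> i)"
    and "haar_condition n \<psi> a b"
    and "m \<ge> n + 1"
    and "x ` {1..m} \<subseteq> {a..b}"
    and "strict_mono_on {1..m} x"
    and "pstar \<in> span_on n \<psi> a b"
  shows "(minimax_solution (span_on n \<psi> a b) m x f pstar \<and>
          (\<forall>q. minimax_solution (span_on n \<psi> a b) m x f q \<longrightarrow> q = pstar))
     \<longleftrightarrow>
       (\<exists>\<beta> :: nat \<Rightarrow> nat. \<beta> ` {1..n+1} \<subseteq> {1..m} \<and>
          strict_mono_on {1..n+1} (\<lambda>j. x (\<beta> j)) \<and>
          ((\<forall>j\<in>{1..n+1}. pstar (x (\<beta> j)) - f (x (\<beta> j))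
                = (-1) ^ j * discrete_norm m x (\<lambda>t. pstar t - f t)) \<or>
           (\<forall>j\<in>{1..n+1}. pstar (x (\<beta> j)) - f (x (\<beta> j))
                = (-1) ^ (j + 1) * discrete_norm m x (\<lambda>t. pstar t - f t))))"
proof -
  interpret haar_system n \<psi> a b
    using assms(2,3) by unfold_locales auto
  let ?P = "span_on n \<psi> a b"
  define E where "E g = (MAX j\<in>{1..m}. \<bar>f (x j) - g (x j)\<bar>)" for g
  have x_in: "x j \<in> {a..b}" if "j \<in> {1..m}" for j
    using assms(5) that by blast
  have E_le: "E (\<lambda>t\<in>{a..b}. lincomb d t) \<le> B \<longleftrightarrow> (\<forall>t\<in>x ` {1..m}. \<bar>f t - lincomb d t\<bar> \<le> B)"
    for d B
  proof -
    have "E (\<lambda>t\<in>{a..b}. lincomb d t) = (MAX j\<in>{1..m}. \<bar>f (x j) - lincomb d (x j)\<bar>)"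
      unfolding E_def by (intro arg_cong[of _ _ Max] image_cong refl) (simp only: restrict_apply' x_in)
    then show ?thesis using assms(1,4) by simp
  qed
  have norm: "discrete_norm m x (\<lambda>t. g t - f t) = E g" for g
    by (simp add: discrete_norm_def E_def abs_minus_commute)
  have solution: "minimax_solution ?P m x f p \<longleftrightarrow> p \<in> ?P \<and> (\<forall>q\<in>?P. E p \<le> E q)" for p
    by (auto simp: minimax_solution_def is_arg_min_linorder E_def)
  have span: "p \<in> ?P \<longleftrightarrow> (\<exists>c. p = (\<lambda>t\<in>{a..b}. lincomb c t))" for p
    by (auto simp: span_on_def lincomb_def)
  obtain c where c: "pstar = (\<lambda>t\<in>{a..b}. lincomb c t)"
    using assms(7) span by blast
  have E_bound: "\<bar>f t - lincomb c t\<bar> \<le> E pstar" if "t \<in> x ` {1..m}" for t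
    using E_le[of c "E pstar"] that unfolding c by blast
  have inj: "inj_on x {1..m}" using assms(6) by (rule strict_mono_on_imp_inj_on)
  have E_nonneg: "0 \<le> E pstar"
    using order_trans[OF abs_ge_zero E_bound[of "x 1"]] assms(4) by simp
  have signs: "(\<forall>j\<in>{1..n+1}. pstar (x (\<beta> j)) - f (x (\<beta> j)) = (-1) ^ j * E pstar) \<or>
      (\<forall>j\<in>{1..n+1}. pstar (x (\<beta> j)) - f (x (\<beta> j)) = (-1) ^ (j + 1) * E pstar) \<longleftrightarrow>
      levelled f ((\<lambda>j. x (\<beta> j)) ` {1..Suc n}) (E pstar) c"
    if \<beta>: "\<beta> ` {1..n+1} \<subseteq> {1..m}" "strict_mono_on {1..n+1} (\<lambda>j. x (\<beta> j))" for \<beta>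
  proof -
    have "x (\<beta> j) \<in> {a..b}" if "j \<in> {1..Suc n}" for j
      using \<beta>(1) that x_in unfolding Suc_eq_plus1 by blast
    then show ?thesis
      using levelled_iff_alternates[of "\<lambda>j. x (\<beta> j)" "E pstar" f c] \<beta>(2) E_nonneg
      by (auto simp: c image_subset_iff)
  qed
  show ?thesis
    unfolding norm
  proof (intro iffI)
    assume "minimax_solution ?P m x f pstar \<and> (\<forall>q. minimax_solution ?P m x f q \<longrightarrow> q = pstar)"
    then have opt: "\<And>q. q \<in> ?P \<Longrightarrow> E pstar \<le> E q" by (simp add: solution)
    have "Suc n \<le> card (x ` {1..m})" using card_image[OF inj] assms(4) by simp
    then obtain A h c' where A: "A \<subseteq> x ` {1..m}" "reference A" and lev: "levelled f A h c'"
        and best: "\<And>t. t \<in> x ` {1..m} \<Longrightarrow> \<bar>f t - lincomb c' t\<bar> \<le> h"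
      using levelled_best_exists[OF finite_imageI[OF finite_atLeastAtMost] assms(5), of f] by blast
    have "E pstar \<le> E (\<lambda>t\<in>{a..b}. lincomb c' t)" by (rule opt) (unfold span, blast)
    also have "\<dots> \<le> h" unfolding E_le using best by blast
    finally have Eh: "E pstar \<le> h" .
    have le: "\<bar>f t - lincomb c t\<bar> \<le> h" if "t \<in> A" for t
      using order_trans[OF E_bound Eh] that A(1) by blast
    have eq: "lincomb c t = lincomb c' t" for t
      by (rule levelled_rigid[OF A(2) lev le])
    obtain t where t: "t \<in> A" using referenceD(4)[OF A(2)] by blast
    then have "h \<le> E pstar"
      using E_bound[of t] A(1) levelled_abs[OF lev t] unfolding eq by auto
    then have lev': "levelled f A (E pstar) c" using lev Eh by (simp add: levelled_def eq)
    \<comment> \<open>Listing the indices of the points of \<open>A\<close> in increasing order gives \<open>\<beta>\<close>; the enumeration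
      \<open>e\<close> starts at \<open>0\<close> and \<open>\<beta>\<close> at \<open>1\<close>.\<close>
    define S where "S = {j \<in> {1..m}. x j \<in> A}"
    have xS: "x ` S = A" using A(1) by (auto simp: S_def)
    have finS: "finite S" by (simp add: S_def)
    have "inj_on x S" by (rule inj_on_subset[OF inj]) (auto simp: S_def)
    from card_image[OF this] have cardS: "card S = Suc n"
      using xS referenceD(3)[OF A(2)] by simp
    obtain e where e: "bij_betw e {..<Suc n} S" "strict_mono_on {..<Suc n} e"
      using ex_bij_betw_strict_mono_card[OF finS] unfolding cardS by blast
    define \<beta> where "\<beta> j = e (j - 1)" for j
    have \<beta>S: "\<beta> ` {1..Suc n} = S"
    proof -
      have "\<beta> ` {1..Suc n} = e ` {..<Suc n}"
        unfolding image_Suc_lessThan[symmetric] image_image by (simp add: \<beta>_def)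
      then show ?thesis using e(1) by (simp add: bij_betw_def)
    qed
    have \<beta>m: "\<beta> ` {1..n+1} \<subseteq> {1..m}" using \<beta>S by (auto simp: S_def)
    have mono: "strict_mono_on {1..n+1} (\<lambda>j. x (\<beta> j))"
    proof (rule strict_mono_onI)
      fix i j assume ij: "i \<in> {1..n+1}" "j \<in> {1..n+1}" "i < j"
      then have "\<beta> i < \<beta> j" using strict_mono_onD[OF e(2), of "i - 1" "j - 1"] by (auto simp: \<beta>_def)
      moreover have "\<beta> i \<in> {1..m}" "\<beta> j \<in> {1..m}" using \<beta>m ij by blast+
      ultimately show "x (\<beta> i) < x (\<beta> j)" using strict_mono_onD[OF assms(6)] by blast
    qed
    have "(\<lambda>j. x (\<beta> j)) ` {1..Suc n} = A"
      using \<beta>S xS by (metis image_image)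
    with lev' signs[OF \<beta>m mono] \<beta>m mono
    show "\<exists>\<beta>. \<beta> ` {1..n+1} \<subseteq> {1..m} \<and> strict_mono_on {1..n+1} (\<lambda>j. x (\<beta> j)) \<and>
        ((\<forall>j\<in>{1..n+1}. pstar (x (\<beta> j)) - f (x (\<beta> j)) = (-1) ^ j * E pstar) \<or>
         (\<forall>j\<in>{1..n+1}. pstar (x (\<beta> j)) - f (x (\<beta> j)) = (-1) ^ (j + 1) * E pstar))"
      by (intro exI[of _ \<beta>]) simp
  next
    assume "\<exists>\<beta>. \<beta> ` {1..n+1} \<subseteq> {1..m} \<and> strict_mono_on {1..n+1} (\<lambda>j. x (\<beta> j)) \<and>
        ((\<forall>j\<in>{1..n+1}. pstar (x (\<beta> j)) - f (x (\<beta> j)) = (-1) ^ j * E pstar) \<or>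
         (\<forall>j\<in>{1..n+1}. pstar (x (\<beta> j)) - f (x (\<beta> j)) = (-1) ^ (j + 1) * E pstar))"
    then obtain \<beta> where \<beta>: "\<beta> ` {1..n+1} \<subseteq> {1..m}" "strict_mono_on {1..n+1} (\<lambda>j. x (\<beta> j))"
      and lev: "levelled f ((\<lambda>j. x (\<beta> j)) ` {1..Suc n}) (E pstar) c"
      using signs by blast
    let ?A = "(\<lambda>j. x (\<beta> j)) ` {1..Suc n}"
    have A: "reference ?A"
      using card_image[OF strict_mono_on_imp_inj_on[OF \<beta>(2)]] \<beta>(1) x_in
      by (auto simp: reference_def)
    have unique: "q = pstar" if q: "q \<in> ?P" "E q \<le> E pstar" for q
    proof -
      obtain c' where c': "q = (\<lambda>t\<in>{a..b}. lincomb c' t)" using q(1) span by blast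
      have le: "\<bar>f t - lincomb c' t\<bar> \<le> E pstar" if t: "t \<in> ?A" for t
      proof -
        have "t \<in> x ` {1..m}" using t \<beta>(1) unfolding Suc_eq_plus1 by blast
        then show ?thesis using q(2) unfolding c' E_le by blast
      qed
      have "lincomb c' t = lincomb c t" for t
        by (rule levelled_rigid[OF A lev le])
      then show ?thesis by (simp add: c c')
    qed
    then have "\<forall>q\<in>?P. E pstar \<le> E q" by (metis linear)
    then show "minimax_solution ?P m x f pstar \<and> (\<forall>q. minimax_solution ?P m x f q \<longrightarrow> q = pstar)"
      using unique assms(7) by (auto simp: solution)
  qed
qed

end
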